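(* For every integer $k\ge 1$, $\chi_{la}((2k+1)P_3\vee O_3)=3$.
   Context: All graphs are finite and simple. For a graph $G=(V,E)$ with $q=|E|$ edges, a bijection $f:E\to\{1,2,\dots,q\}$ is a local antimagic labeling of $G$ if $f^+(u)\ne f^+(v)$ for every edge $uv\in E$, where $f^+(u)=\sum_{e\in E(u)}f(e)$ and $E(u)$ is the set of edges incident to $u$. The color number $c(f)$ is the number of distinct values of $f^+$ on $V$. The local antimagic chromatic number $\chi_{la}(G)$ is the minimum of $c(f)$ over all local antimagic labelings $f$ of $G$. $P_3$ is the path on 3 vertices, $nP_3$ is the disjoint union of $n$ copies of $P_3$, $O_3$ is the null (edgeless) graph on 3 vertices, and $G\vee H$ is the join of $G$ and $H$ (disjoint union together with all edges between $G$ and $H$); $(2k+1)P_3\vee O_3$ means $((2k+1)P_3)\vee O_3$. *)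

theory Defs
  imports "HOL-Library.Extended_Nat"
begin

record 'a graph =
  verts :: "'a set"
  edges :: "'a set set"

definition finite_simple_graph :: "'a graph \<Rightarrow> bool" where
  "finite_simple_graph G \<longleftrightarrow>
     finite (verts G) \<and> (\<forall>e\<in>edges G. e \<subseteq> verts G \<and> card e = 2)"

definition path_graph :: "nat \<Rightarrow> nat graph" where
  "path_graph n = \<lparr>verts = {..<n}, edges = {{i, Suc i} |i. Suc i < n}\<rparr>"

definition null_graph :: "nat \<Rightarrow> nat graph" where
  "null_graph n = \<lparr>verts = {..<n}, edges = {}\<rparr>"

text \<open>Disjoint union of \<open>n\<close> copies of \<open>G\<close>; vertex \<open>(i, v)\<close> is the vertex \<open>v\<close> of copy \<open>i\<close>.\<close>
definition copies :: "nat \<Rightarrow> 'a graph \<Rightarrow> (nat \<times> 'a) graph" where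
  "copies n G = \<lparr>verts = {..<n} \<times> verts G,
                 edges = {Pair i ` e |i e. i < n \<and> e \<in> edges G}\<rparr>"

definition join :: "'a graph \<Rightarrow> 'b graph \<Rightarrow> ('a + 'b) graph" where
  "join G H = \<lparr>verts = verts G <+> verts H,
               edges = (`) Inl ` edges G \<union> (`) Inr ` edges H \<union>
                       {{Inl u, Inr v} |u v. u \<in> verts G \<and> v \<in> verts H}\<rparr>"

definition incident_edges :: "'a graph \<Rightarrow> 'a \<Rightarrow> 'a set set" where
  "incident_edges G v = {e \<in> edges G. v \<in> e}"

definition vertex_sum :: "'a graph \<Rightarrow> ('a set \<Rightarrow> nat) \<Rightarrow> 'a \<Rightarrow> nat" where
  "vertex_sum G f v = (\<Sum>e\<in>incident_edges G v. f e)"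

text \<open>Only the values of \<open>f\<close> on \<open>edges G\<close> matter here.\<close>
definition local_antimagic_labeling :: "'a graph \<Rightarrow> ('a set \<Rightarrow> nat) \<Rightarrow> bool" where
  "local_antimagic_labeling G f \<longleftrightarrow>
     bij_betw f (edges G) {1..card (edges G)} \<and>
     (\<forall>u v. {u, v} \<in> edges G \<longrightarrow> vertex_sum G f u \<noteq> vertex_sum G f v)"

definition color_number :: "'a graph \<Rightarrow> ('a set \<Rightarrow> nat) \<Rightarrow> nat" where
  "color_number G f = card (vertex_sum G f ` verts G)"

text \<open>The value is \<open>\<infinity>\<close> if \<open>G\<close> has no local antimagic labeling; otherwise the infimum is
  attained, see \<open>chi_la_eq_enat_iff\<close>.\<close>
definition chi_la :: "'a graph \<Rightarrow> enat" where
  "chi_la G = (INF f\<in>{f. local_antimagic_labeling G f}. enat (color_number G f))"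

lemma chi_la_eq_enat_iff:
  "chi_la G = enat m \<longleftrightarrow>
     (\<exists>f. local_antimagic_labeling G f \<and> color_number G f = m) \<and>
     (\<forall>f. local_antimagic_labeling G f \<longrightarrow> m \<le> color_number G f)"
proof -
  let ?A = "(\<lambda>f. enat (color_number G f)) ` {f. local_antimagic_labeling G f}"
  have low: "chi_la G \<le> enat (color_number G f)" if "local_antimagic_labeling G f" for f
    unfolding chi_la_def using that by (intro INF_lower) simp
  show ?thesis
  proof (intro iffI conjI allI impI)
    assume eq: "chi_la G = enat m"
    then have "?A \<noteq> {}" by (metis Inf_empty chi_la_def enat.distinct(1) top_enat_def)
    then have "Inf ?A \<in> ?A" using wellorder_InfI by (metis ex_in_conv)
    then show "\<exists>f. local_antimagic_labeling G f \<and> color_number G f = m"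
      using eq by (auto simp: chi_la_def)
  next
    fix f assume "chi_la G = enat m" "local_antimagic_labeling G f"
    then show "m \<le> color_number G f" using low by fastforce
  next
    assume *: "(\<exists>f. local_antimagic_labeling G f \<and> color_number G f = m) \<and>
      (\<forall>f. local_antimagic_labeling G f \<longrightarrow> m \<le> color_number G f)"
    then have "enat m \<le> chi_la G" unfolding chi_la_def by (intro INF_greatest) simp
    then show "chi_la G = enat m" using * low by (metis order_antisym)
  qed
qed

lemma finite_simple_path_graph: "finite_simple_graph (path_graph n)"
  by (auto simp: finite_simple_graph_def path_graph_def)

lemma finite_simple_null_graph: "finite_simple_graph (null_graph n)"
  by (simp add: finite_simple_graph_def null_graph_def)

lemma finite_simple_copies:
  "finite_simple_graph G \<Longrightarrow> finite_simple_graph (copies n G)"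
  by (auto simp: finite_simple_graph_def copies_def card_image inj_on_def)

lemma finite_simple_join:
  "finite_simple_graph G \<Longrightarrow> finite_simple_graph H \<Longrightarrow> finite_simple_graph (join G H)"
  by (auto simp: finite_simple_graph_def join_def card_image inj_on_def)

end

theory Submission
  imports Defs
begin

text \<open>
  A triangle forces three colors. Conversely, put \<open>n = 2k + 1\<close> and cut \<open>{1..11n}\<close> into \<open>11\<close>
  blocks of \<open>n\<close> consecutive labels, one block for each of the \<open>11\<close> edges that belong to a copy
  of \<open>P\<^sub>3\<close>; within its block, an edge of copy \<open>i\<close> is placed by a permutation of \<open>{0..2k}\<close>.
  The sums at the vertices of \<open>P\<^sub>3\<close> do not depend on \<open>i\<close> because the permutations there
  split into groups with constant sum: pairs \<open>i\<close>, \<open>2k - i\<close> and, at the center, a triple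
  \<open>i\<close>, \<open>\<sigma> i\<close>, \<open>3k - i - \<sigma> i\<close>, which exists because \<open>n\<close> is odd. The sums at the vertices of \<open>O\<^sub>3\<close>
  only depend on the block numbers, which are chosen as in a magic rectangle.
\<close>

section \<open>General tools: a lower bound, vertex sums over indexed edges, labels arranged in
  blocks\<close>

lemma color_number_triangle:
  assumes "finite (verts G)" "local_antimagic_labeling G f"
    and "{u, v, w} \<subseteq> verts G" "{u, v} \<in> edges G" "{u, w} \<in> edges G" "{v, w} \<in> edges G"
  shows "3 \<le> color_number G f"
proof -
  have "card {vertex_sum G f u, vertex_sum G f v, vertex_sum G f w} = 3"
    using assms by (auto simp: local_antimagic_labeling_def)
  moreover have "{vertex_sum G f u, vertex_sum G f v, vertex_sum G f w} \<subseteq> vertex_sum G f ` verts G"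
    using assms by auto
  ultimately show ?thesis
    using assms(1) unfolding color_number_def by (metis card_mono finite_imageI)
qed

text \<open>Labels are easier to define on an index set than on edges. This transports such labels
  \<open>L\<close> along an enumeration \<open>E\<close> of the edges and turns vertex sums into
  sums over indices.\<close>

lemma vertex_sum_reindex:
  assumes "bij_betw E I (edges G)" "finite I"
  shows "vertex_sum G (L \<circ> the_inv_into I E) v = (\<Sum>x\<in>I. if v \<in> E x then L x else 0)"
proof -
  have "bij_betw E {x \<in> I. v \<in> E x} (incident_edges G v)"
  proof (rule bij_betw_subset[OF assms(1)])
    have "edges G = E ` I" using assms(1) by (simp add: bij_betw_def)
    then show "E ` {x \<in> I. v \<in> E x} = incident_edges G v"
      by (auto simp: incident_edges_def)
  qed auto
  then have "vertex_sum G (L \<circ> the_inv_into I E) v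
      = (\<Sum>x\<in>{x \<in> I. v \<in> E x}. (L \<circ> the_inv_into I E) (E x))"
    unfolding vertex_sum_def by (rule sum.reindex_bij_betw[symmetric])
  also have "\<dots> = (\<Sum>x\<in>{x \<in> I. v \<in> E x}. L x)"
    using assms(1) by (intro sum.cong) (auto simp: bij_betw_def the_inv_into_f_f)
  also have "\<dots> = (\<Sum>x\<in>I. if v \<in> E x then L x else 0)"
    using assms(2) by (simp add: sum.inter_filter)
  finally show ?thesis .
qed

lemma bij_betw_blocks:
  fixes m n :: nat
  assumes blk: "bij_betw blk {..<m} {..<m}"
    and perm: "\<And>r. r < m \<Longrightarrow> bij_betw (\<lambda>i. perm i r) {..<n} {..<n}"
  shows "bij_betw (\<lambda>(i, r). n * blk r + perm i r + 1) ({..<n} \<times> {..<m}) {1..m * n}"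
proof -
  let ?L = "\<lambda>(i, r). n * blk r + perm i r + 1"
  have lt: "perm i r < n" if "i < n" "r < m" for i r
    using perm[OF that(2)] that(1) by (auto simp: bij_betw_def)
  have blk_lt: "blk r < m" if "r < m" for r
    using blk that by (auto simp: bij_betw_def)
  have inj: "inj_on ?L ({..<n} \<times> {..<m})"
  proof (rule inj_onI)
    fix x y
    assume "x \<in> {..<n} \<times> {..<m}" "y \<in> {..<n} \<times> {..<m}" "?L x = ?L y"
    then obtain i r i' r' where xy: "x = (i, r)" "y = (i', r')"
      and le: "i \<in> {..<n}" "r \<in> {..<m}" "i' \<in> {..<n}" "r' \<in> {..<m}"
      and eq: "n * blk r + perm i r = n * blk r' + perm i' r'" by auto
    \<comment> \<open>Since \<open>perm i r < n\<close>, the label determines the block as a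
      quotient by \<open>n\<close> and the place as the remainder.\<close>
    have "(n * blk r + perm i r) div n = blk r" "(n * blk r' + perm i' r') div n = blk r'"
      using lt[of i r] lt[of i' r'] le by auto
    with eq have "blk r = blk r'" by simp
    then have "r = r'" using blk le by (auto simp: bij_betw_def inj_on_def)
    with eq have "perm i r = perm i' r" by simp
    then have "i = i'" using perm[of r] le by (auto simp: bij_betw_def inj_on_def)
    with \<open>r = r'\<close> xy show "x = y" by simp
  qed
  have "?L ` ({..<n} \<times> {..<m}) \<subseteq> {1..m * n}"
  proof (rule image_subsetI)
    fix x assume "x \<in> {..<n} \<times> {..<m}"
    then obtain i r where x: "x = (i, r)" and "i < n" "r < m" by auto
    then have "perm i r < n" "Suc (blk r) \<le> m" using lt blk_lt by (auto simp: Suc_le_eq)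
    from this(1) mult_le_mono1[OF this(2), of n]
    show "?L x \<in> {1..m * n}" by (simp add: x mult.commute)
  qed
  \<comment> \<open>Surjectivity comes from counting: both sides have \<open>m * n\<close>
    elements.\<close>
  moreover have "card (?L ` ({..<n} \<times> {..<m})) = card {1..m * n}"
    using card_image[OF inj] by (simp add: mult.commute)
  ultimately show ?thesis
    using inj by (simp add: bij_betw_def card_subset_eq)
qed

section \<open>Permutations of \<open>{..<2 * k + 1}\<close> with constant sums\<close>

text \<open>The cyclic shift by \<open>k\<close> modulo \<open>2 * k + 1\<close>.\<close>

definition sigma :: "nat \<Rightarrow> nat \<Rightarrow> nat" where
  "sigma k i = (if i \<le> k then i + k else i - k - 1)"

text \<open>The closed form of \<open>3 * k - i - sigma k i\<close>; the total \<open>3 * k\<close>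
  is forced, because each of the three permutations has mean \<open>k\<close>.\<close>

definition tau :: "nat \<Rightarrow> nat \<Rightarrow> nat" where
  "tau k i = (if i \<le> k then 2 * k - 2 * i else 4 * k + 1 - 2 * i)"

lemma bij_betw_lessThan_nat:
  fixes f :: "nat \<Rightarrow> nat"
  assumes "inj_on f {..<n}" "f ` {..<n} \<subseteq> {..<n}"
  shows "bij_betw f {..<n} {..<n}"
  using assms by (simp add: bij_betw_def endo_inj_surj)

lemma bij_sigma: "bij_betw (sigma k) {..<2 * k + 1} {..<2 * k + 1}"
  by (rule bij_betw_lessThan_nat) (auto simp: sigma_def inj_on_def)

text \<open>The first case of \<open>tau\<close> runs down the even numbers from
  \<open>2 * k\<close> to 0, the second down the odd numbers from \<open>2 * k - 1\<close> to 1, so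
  parity separates the two cases.\<close>

lemma bij_tau: "bij_betw (tau k) {..<2 * k + 1} {..<2 * k + 1}"
proof (rule bij_betw_lessThan_nat)
  show "inj_on (tau k) {..<2 * k + 1}"
    by (rule inj_onI) (simp add: tau_def split: if_splits; presburger)
qed (auto simp: tau_def)

lemma bij_reflect:
  fixes f :: "nat \<Rightarrow> nat" and k :: nat
  assumes "bij_betw f {..<2 * k + 1} {..<2 * k + 1}"
  shows "bij_betw (\<lambda>i. 2 * k - f i) {..<2 * k + 1} {..<2 * k + 1}"
proof (rule bij_betw_lessThan_nat)
  \<comment> \<open>This bound keeps the truncated subtraction \<open>2 * k - f i\<close> exact and
    hence injective.\<close>
  have "f i \<le> 2 * k" if "i < 2 * k + 1" for i
    using bij_betwE[OF assms] that by (simp add: less_Suc_eq_le)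
  then show "inj_on (\<lambda>i. 2 * k - f i) {..<2 * k + 1}"
    using assms unfolding bij_betw_def inj_on_def
    by (metis diff_diff_cancel lessThan_iff)
qed auto

lemma sigma_le: "i \<le> 2 * k \<Longrightarrow> sigma k i \<le> 2 * k"
  by (auto simp: sigma_def)

lemma id_sigma_tau: "i \<le> 2 * k \<Longrightarrow> i + sigma k i + tau k i = 3 * k"
  by (auto simp: sigma_def tau_def)

text \<open>Summed over all copies, every choice of permutation contributes the same, which is why
  the sums at the null graph depend on the blocks alone.\<close>

lemma sum_bij_lessThan:
  fixes f :: "nat \<Rightarrow> nat" and k :: nat
  assumes "bij_betw f {..<2 * k + 1} {..<2 * k + 1}"
  shows "(\<Sum>i<2 * k + 1. f i) = k * (2 * k + 1)"
proof -
  have "(\<Sum>i<2 * k + 1. f i) = (\<Sum>i<2 * k + 1. i)"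
    by (rule sum.reindex_bij_betw[OF assms])
  also have "\<dots> = k * (2 * k + 1)"
    using gauss_sum_nat[of "2 * k"] by (simp add: lessThan_Suc_atMost atLeast0AtMost)
  finally show ?thesis .
qed

section \<open>The edges of the join and their labels\<close>

text \<open>
  Index \<open>(i, 3 * t + j)\<close> is the edge from vertex \<open>t\<close> of copy \<open>i\<close> to vertex \<open>j\<close> of \<open>O\<^sub>3\<close>;
  indices \<open>(i, 9)\<close> and \<open>(i, 10)\<close> are the two edges of copy \<open>i\<close>.
\<close>
definition edge_of :: "nat \<times> nat \<Rightarrow> ((nat \<times> nat) + nat) set" where
  "edge_of = (\<lambda>(i, r). if r < 9 then {Inl (i, r div 3), Inr (r mod 3)}
                       else {Inl (i, r - 9), Inl (i, r - 8)})"

text \<open>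
  The columns of the 3-by-3 part (rows 6 5 8, 10 4 3, 2 9 7) all sum to 18, and
  \<open>6 + 5 + 8 + 0 = 2 + 9 + 7 + 1\<close> makes the two leaves agree.
\<close>
definition block :: "nat \<Rightarrow> nat" where
  "block r = [6, 5, 8, 10, 4, 3, 2, 9, 7, 0, 1] ! r"

text \<open>By position in the list, the pairs with sum \<open>2 * k\<close> are 0, 1 and 2, 9 at
  the first leaf; 6, 10 and 7, 8 at the second; 4, 5 at the center. The center also has the triple
  3, 9, 10 with sum \<open>3 * k\<close>.\<close>

definition place :: "nat \<Rightarrow> nat \<Rightarrow> nat \<Rightarrow> nat" where
  "place k i r = [2 * k - i, i, 2 * k - i, tau k i, i, 2 * k - i,
                  2 * k - sigma k i, i, 2 * k - i, i, sigma k i] ! r"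

definition label :: "nat \<Rightarrow> nat \<times> nat \<Rightarrow> nat" where
  "label k = (\<lambda>(i, r). (2 * k + 1) * block r + place k i r + 1)"

abbreviation join_graph :: "nat \<Rightarrow> ((nat \<times> nat) + nat) graph" where
  "join_graph n \<equiv> join (copies n (path_graph 3)) (null_graph 3)"

lemma verts_join_graph: "verts (join_graph n) = ({..<n} \<times> {..<3}) <+> {..<3}"
  by (simp add: join_def copies_def path_graph_def null_graph_def)

lemma less_11_cases:
  fixes r :: nat
  assumes "r < 11"
  obtains "r = 0" | "r = 1" | "r = 2" | "r = 3" | "r = 4" | "r = 5" | "r = 6" | "r = 7" | "r = 8"
    | "r = 9" | "r = 10"
  using assms by (auto simp: less_Suc_eq eval_nat_numeral)

lemma edges_join_graph: "edges (join_graph n) = edge_of ` ({..<n} \<times> {..<11})"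
proof -
  have "edges (join_graph n)
      = {{Inl (i, t), Inl (i, Suc t)} |i t. i < n \<and> t < 2} \<union>
        {{Inl (i, t), Inr j} |i t j. i < n \<and> t < 3 \<and> j < 3}" (is "_ = ?P \<union> ?J")
  proof -
    have "edges (path_graph 3) = (\<lambda>t. {t, Suc t}) ` {..<2}"
      by (auto simp: path_graph_def)
    moreover have "edges (copies n (path_graph 3)) = (\<Union>i<n. (`) (Pair i) ` edges (path_graph 3))"
      by (auto simp: copies_def)
    ultimately have "(`) Inl ` edges (copies n (path_graph 3))
        = (\<Union>i<n. (\<lambda>t. {Inl (i, t), Inl (i, Suc t)}) ` {..<2})"
      by (simp add: image_UN image_image)
    also have "\<dots> = ?P" by auto
    finally have "(`) Inl ` edges (copies n (path_graph 3)) = ?P" .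
    then show ?thesis
      by (auto simp: join_def copies_def path_graph_def null_graph_def)
  qed
  also have "\<dots> = edge_of ` ({..<n} \<times> {..<11})"
  proof (intro equalityI subsetI)
    fix e assume "e \<in> ?P \<union> ?J"
    then consider i t where "i < n" "t < 2" "e = {Inl (i, t), Inl (i, Suc t)}"
      | i t j where "i < n" "t < 3" "j < 3" "e = {Inl (i, t), Inr j}" by blast
    then show "e \<in> edge_of ` ({..<n} \<times> {..<11})"
    proof cases
      case 1
      then show ?thesis
        by (intro image_eqI[of _ _ "(i, t + 9)"]) (auto simp: edge_of_def)
    next
      case 2
      then show ?thesis
        by (intro image_eqI[of _ _ "(i, 3 * t + j)"]) (auto simp: edge_of_def)
    qed
  next
    fix e assume "e \<in> edge_of ` ({..<n} \<times> {..<11})"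
    then obtain i r where *: "i < n" "r < 11" "e = edge_of (i, r)" by auto
    show "e \<in> ?P \<union> ?J"
    proof (cases "r < 9")
      case True
      with * have "e = {Inl (i, r div 3), Inr (r mod 3)}" "r div 3 < 3" "r mod 3 < 3"
        by (auto simp: edge_of_def)
      with * show ?thesis by blast
    next
      case False
      with * have "e = {Inl (i, r - 9), Inl (i, Suc (r - 9))}" "r - 9 < 2"
        by (auto simp: edge_of_def Suc_diff_le)
      with * show ?thesis by blast
    qed
  qed
  finally show ?thesis .
qed

lemma inj_on_edge_of: "inj_on edge_of (UNIV \<times> {..<11})"
proof (rule inj_onI)
  have div_mod_eqI: "r = r'" if "r div 3 = r' div 3" "r mod 3 = r' mod 3" for r r' :: nat
    using that by (metis div_mult_mod_eq)
  fix x y :: "nat \<times> nat"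
  assume "x \<in> UNIV \<times> {..<11}" "y \<in> UNIV \<times> {..<11}" "edge_of x = edge_of y"
  then show "x = y"
    by (cases "snd x < 9"; cases "snd y < 9")
      (auto simp: edge_of_def doubleton_eq_iff dest: div_mod_eqI)
qed

lemma bij_edge_of: "bij_betw edge_of ({..<n} \<times> {..<11}) (edges (join_graph n))"
  unfolding bij_betw_def edges_join_graph
  using inj_on_edge_of by (rule conjI[OF inj_on_subset]) auto

lemma bij_block: "bij_betw block {..<11} {..<11}"
proof (rule bij_betw_lessThan_nat)
  show "inj_on block {..<11}"
    by (simp add: lessThan_nat_numeral lessThan_Suc block_def)
  show "block ` {..<11} \<subseteq> {..<11}"
    by (simp add: lessThan_nat_numeral lessThan_Suc block_def)
qed

lemma bij_place:
  assumes "r < 11"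
  shows "bij_betw (\<lambda>i. place k i r) {..<2 * k + 1} {..<2 * k + 1}"
proof -
  have id: "bij_betw (\<lambda>i. i) {..<2 * k + 1} {..<2 * k + 1}"
    by (simp add: bij_betw_def)
  note bijs = id bij_reflect[OF id] bij_sigma bij_tau bij_reflect[OF bij_sigma]
  from assms show ?thesis
    by (cases rule: less_11_cases) (use bijs in \<open>simp_all add: place_def\<close>)
qed

lemma bij_label: "bij_betw (label k) ({..<2 * k + 1} \<times> {..<11}) {1..11 * (2 * k + 1)}"
  unfolding label_def by (rule bij_betw_blocks[OF bij_block bij_place])

definition labeling :: "nat \<Rightarrow> ((nat \<times> nat) + nat) set \<Rightarrow> nat" where
  "labeling k = label k \<circ> the_inv_into ({..<2 * k + 1} \<times> {..<11}) edge_of"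

section \<open>Vertex sums of the labeling\<close>

lemma vertex_sum_labeling:
  "vertex_sum (join_graph (2 * k + 1)) (labeling k) v
    = (\<Sum>i<2 * k + 1. \<Sum>r<11. if v \<in> edge_of (i, r) then label k (i, r) else 0)"
  unfolding labeling_def
  by (subst vertex_sum_reindex[OF bij_edge_of])
    (auto simp: sum.cartesian_product intro!: sum.cong)

text \<open>A vertex of copy \<open>i\<close> meets only edges indexed by \<open>i\<close>, so the
  sum over copies collapses to one term.\<close>

lemma vertex_sum_copy:
  assumes "i < 2 * k + 1"
  shows "vertex_sum (join_graph (2 * k + 1)) (labeling k) (Inl (i, t))
    = (\<Sum>r<11. if Inl (i, t) \<in> edge_of (i, r) then label k (i, r) else 0)"
proof -
  let ?S = "\<lambda>l. \<Sum>r<11. if Inl (i, t) \<in> edge_of (l, r) then label k (l, r) else 0"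
  have "?S l = (if l = i then ?S i else 0)" for l
    by (auto simp: edge_of_def)
  then have "(\<Sum>l<2 * k + 1. ?S l) = (\<Sum>l<2 * k + 1. if l = i then ?S i else 0)"
    by (intro sum.cong) auto
  then show ?thesis
    unfolding vertex_sum_labeling using assms by (simp del: sum.lessThan_Suc)
qed

text \<open>Four edges meet at a leaf: the blocks add up to 19 and the places to
  \<open>4 * k\<close>, giving \<open>19 * (2 * k + 1) + 4 * k + 4\<close>.\<close>

lemma vertex_sum_leaf:
  assumes "i < 2 * k + 1" "t = 0 \<or> t = 2"
  shows "vertex_sum (join_graph (2 * k + 1)) (labeling k) (Inl (i, t)) = 42 * k + 23"
proof -
  have "i \<le> 2 * k" using assms(1) by simp
  from this sigma_le[OF this] assms(2) show ?thesis
    unfolding vertex_sum_copy[OF assms(1)]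
    by (auto simp: lessThan_nat_numeral lessThan_Suc edge_of_def
        label_def block_def place_def)
qed

text \<open>Five edges meet at a center: the blocks add up to 18 and the places to
  \<open>5 * k\<close>, giving \<open>18 * (2 * k + 1) + 5 * k + 5\<close>.\<close>

lemma vertex_sum_center:
  assumes "i < 2 * k + 1"
  shows "vertex_sum (join_graph (2 * k + 1)) (labeling k) (Inl (i, 1)) = 41 * k + 23"
proof -
  have "i \<le> 2 * k" using assms(1) by simp
  from this id_sigma_tau[OF this] show ?thesis
    unfolding vertex_sum_copy[OF assms(1)]
    by (auto simp: lessThan_nat_numeral lessThan_Suc edge_of_def
        label_def block_def place_def)
qed

lemma sum_label:
  assumes "r < 11"
  shows "(\<Sum>i<2 * k + 1. label k (i, r)) = (2 * k + 1) * ((2 * k + 1) * block r + k + 1)"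
proof -
  have "(\<Sum>i<2 * k + 1. label k (i, r))
      = (\<Sum>i<2 * k + 1. place k i r) + (\<Sum>i<2 * k + 1. (2 * k + 1) * block r + 1)"
    unfolding label_def sum.distrib[symmetric] by (intro sum.cong) auto
  also have "\<dots> = (2 * k + 1) * ((2 * k + 1) * block r + k + 1)"
    unfolding sum_bij_lessThan[OF bij_place[OF assms]] sum_constant by (simp add: algebra_simps)
  finally show ?thesis .
qed

lemma vertex_sum_null:
  assumes "j < 3"
  shows "vertex_sum (join_graph (2 * k + 1)) (labeling k) (Inr j)
    = (2 * k + 1) * (39 * k + 21)"
proof -
  have "(\<Sum>r<11. if Inr j \<in> edge_of (i, r) then label k (i, r) else 0)
      = label k (i, j) + label k (i, 3 + j) + label k (i, 6 + j)" for i
  proof -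
    consider "j = 0" | "j = 1" | "j = 2" using assms by linarith
    then show ?thesis
      by cases (simp_all add: lessThan_nat_numeral lessThan_Suc edge_of_def)
  qed
  then have "vertex_sum (join_graph (2 * k + 1)) (labeling k) (Inr j)
      = (\<Sum>i<2 * k + 1. label k (i, j)) + (\<Sum>i<2 * k + 1. label k (i, 3 + j))
        + (\<Sum>i<2 * k + 1. label k (i, 6 + j))"
    unfolding vertex_sum_labeling sum.distrib[symmetric] by (intro sum.cong) auto
  also have "\<dots> = (2 * k + 1) * ((2 * k + 1) * (block j + block (3 + j) + block (6 + j)) + 3 * k + 3)"
  proof -
    have "j < 11" "3 + j < 11" "6 + j < 11" using assms by simp_all
    then show ?thesis
      unfolding sum_label[OF \<open>j < 11\<close>] sum_label[OF \<open>3 + j < 11\<close>] sum_label[OF \<open>6 + j < 11\<close>]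
      by (simp only: algebra_simps)
  qed
  finally have *: "vertex_sum (join_graph (2 * k + 1)) (labeling k) (Inr j)
      = (2 * k + 1) * ((2 * k + 1) * (block j + block (3 + j) + block (6 + j)) + 3 * k + 3)" .
  have "block j + block (3 + j) + block (6 + j) = 18"
  proof -
    consider "j = 0" | "j = 1" | "j = 2" using assms by linarith
    then show ?thesis by cases (simp_all add: block_def)
  qed
  with * have "vertex_sum (join_graph (2 * k + 1)) (labeling k) (Inr j)
      = (2 * k + 1) * ((2 * k + 1) * 18 + 3 * k + 3)" by (simp only:)
  then show ?thesis by (simp only: algebra_simps)
qed

lemma null_sum_gt:
  fixes k :: nat
  assumes "k \<ge> 1"
  shows "42 * k + 23 < (2 * k + 1) * (39 * k + 21)"
proof -
  \<comment> \<open>At least three copies are present; with a single copy the inequality would fail,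
    as 23 exceeds 21.\<close>
  have "3 * (39 * k + 21) \<le> (2 * k + 1) * (39 * k + 21)"
    using assms by (intro mult_le_mono1) simp
  moreover have "42 * k + 23 < 3 * (39 * k + 21)" by simp
  ultimately show ?thesis by (rule less_le_trans[rotated])
qed

section \<open>Exactly three colors\<close>

text \<open>The bound on \<open>k\<close> enters twice: leaf and center sums differ by exactly
  \<open>k\<close>, and both lie below the sums at the null graph by
  \<open>null_sum_gt\<close>.\<close>

lemma local_antimagic_labeling_join_graph:
  assumes "k \<ge> 1"
  shows "local_antimagic_labeling (join_graph (2 * k + 1)) (labeling k)"
  unfolding local_antimagic_labeling_def
proof (intro conjI allI impI)
  let ?I = "{..<2 * k + 1} \<times> {..<11::nat}"
  have "card (edges (join_graph (2 * k + 1))) = 11 * (2 * k + 1)"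
    using bij_betw_same_card[OF bij_edge_of[of "2 * k + 1"]] by (simp add: card_cartesian_product)
  then show "bij_betw (labeling k) (edges (join_graph (2 * k + 1)))
      {1..card (edges (join_graph (2 * k + 1)))}"
    unfolding labeling_def
    using bij_betw_trans[OF bij_betw_the_inv_into[OF bij_edge_of] bij_label] by simp
next
  let ?s = "vertex_sum (join_graph (2 * k + 1)) (labeling k)"
  note null = null_sum_gt[OF assms]
  fix u v assume "{u, v} \<in> edges (join_graph (2 * k + 1))"
  then obtain i r where i: "i < 2 * k + 1" and r: "r < 11" and e: "{u, v} = edge_of (i, r)"
    unfolding edges_join_graph by auto
  have copy: "?s (Inl (i, t)) \<le> 42 * k + 23" if t: "t < 3" for t
  proof -
    consider "t = 0 \<or> t = 2" | "t = 1" using t by linarith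
    then show ?thesis by cases (use i vertex_sum_leaf vertex_sum_center in auto)
  qed
  show "?s u \<noteq> ?s v"
  proof (cases "r < 9")
    case True
    then have "{u, v} = {Inl (i, r div 3), Inr (r mod 3)}" using e by (simp add: edge_of_def)
    moreover have "?s (Inl (i, r div 3)) < ?s (Inr (r mod 3))"
    proof -
      have "r div 3 < 3" "r mod 3 < 3" using True by auto
      from le_less_trans[OF copy[OF this(1)] null] vertex_sum_null[OF this(2)]
      show ?thesis by (simp only:)
    qed
    ultimately show ?thesis by (auto simp: doubleton_eq_iff)
  next
    case False
    with r consider "r = 9" | "r = 10" by linarith
    then obtain t where "{u, v} = {Inl (i, t), Inl (i, 1)}" "t = 0 \<or> t = 2"
      by cases (use e in \<open>auto simp: edge_of_def doubleton_eq_iff\<close>)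
    then show ?thesis
      using assms vertex_sum_leaf[OF i, of t] vertex_sum_center[OF i]
      by (auto simp: doubleton_eq_iff)
  qed
qed

lemma color_number_labeling:
  "color_number (join_graph (2 * k + 1)) (labeling k) \<le> 3"
proof -
  let ?s = "vertex_sum (join_graph (2 * k + 1)) (labeling k)"
  let ?C = "{42 * k + 23, 41 * k + 23, (2 * k + 1) * (39 * k + 21)}"
  have "?s x \<in> ?C" if "x \<in> verts (join_graph (2 * k + 1))" for x
  proof -
    from that consider i t where "x = Inl (i, t)" "i < 2 * k + 1" "t = 0 \<or> t = 2"
      | i where "x = Inl (i, 1)" "i < 2 * k + 1"
      | j where "x = Inr j" "j < 3"
      unfolding verts_join_graph by (auto simp: less_Suc_eq numeral_3_eq_3 numeral_2_eq_2)
    then show ?thesis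
      by cases (simp_all only: vertex_sum_leaf vertex_sum_center vertex_sum_null insert_iff simp_thms)
  qed
  then have "?s ` verts (join_graph (2 * k + 1)) \<subseteq> ?C" by blast
  \<comment> \<open>Bounding by the length of a list avoids proving the three values distinct; the
    triangle supplies the reverse inequality.\<close>
  moreover have "card ?C \<le> 3"
    using card_length[of "[42 * k + 23, 41 * k + 23, (2 * k + 1) * (39 * k + 21)]"]
    by simp
  ultimately show ?thesis
    unfolding color_number_def by (meson card_mono finite.emptyI finite.insertI le_trans)
qed

theorem theorem4p1:
  fixes k :: nat
  assumes "k \<ge> 1"
  shows "chi_la (join (copies (2 * k + 1) (path_graph 3)) (null_graph 3)) = 3"
proof -
  let ?G = "join_graph (2 * k + 1)"
  have lower: "3 \<le> color_number ?G f" if "local_antimagic_labeling ?G f" for f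
  proof (rule color_number_triangle)
    show "finite (verts ?G)" by (simp add: verts_join_graph)
    show "{Inl (0, 0), Inl (0, 1), Inr 0} \<subseteq> verts ?G" by (auto simp: verts_join_graph)
    \<comment> \<open>An edge of a path and any vertex of the null graph span a triangle.\<close>
    have "{Inl (0, 0), Inl (0, 1)} = edge_of (0, 9)" "{Inl (0, 0), Inr 0} = edge_of (0, 0)"
      "{Inl (0, 1), Inr 0} = edge_of (0, 3)"
      by (simp_all add: edge_of_def)
    then show "{Inl (0, 0), Inl (0, 1)} \<in> edges ?G" "{Inl (0, 0), Inr 0} \<in> edges ?G"
      "{Inl (0, 1), Inr 0} \<in> edges ?G"
      by (auto simp: edges_join_graph)
  qed (rule that)
  have "local_antimagic_labeling ?G (labeling k)"
    using assms by (rule local_antimagic_labeling_join_graph)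
  with lower color_number_labeling have "chi_la ?G = enat 3"
    unfolding chi_la_eq_enat_iff by (meson le_antisym)
  then show ?thesis by (simp add: numeral_eq_enat)
qed

end
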